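(* Let $(\mathbf X,d)$ be a complete length space and $\Omega$ an open set in $\mathbf X$. Assume $f\in C(\Omega)$ with $f\ge0$. Let $u\in C(\Omega)$. Then $u$ is a c-subsolution of $|\nabla u|=f$ in $\Omega$ if and only if it is a Monge subsolution of $|\nabla u|=f$ in $\Omega$.
   Context: $\mathcal A_x(\mathbb R,\Omega)$ is the set of absolutely continuous curves $\xi:\mathbb R\to\Omega$ with metric speed $|\xi'|\le1$ a.e. (i.e. $1$-Lipschitz) and $\xi(0)=x$. An upper semicontinuous $u:\Omega\to\mathbb R$ is a c-subsolution of $|\nabla u|=f$ if for all $x\in\Omega$ and $\xi\in\mathcal A_x(\mathbb R,\Omega)$ one has $|\phi'(0)|\le f(x)$ whenever $\phi\in C^1(\mathbb R)$ is such that $t\mapsto u(\xi(t))-\phi(t)$ has a local maximum at $t=0$. $\mathrm{Lip}_{loc}(\Omega)$ is the set of functions on $\Omega$ that are Lipschitz in a small ball around each point. A function $u$ is a Monge subsolution of $|\nabla u|=f$ if $u\in\mathrm{Lip}_{loc}(\Omega)$ and $|\nabla^-u|(x)\le f(x)$ for every $x\in\Omega$, where $|\nabla^-u|(x)=\limsup_{y\to x}\frac{\max\{u(x)-u(y),0\}}{d(x,y)}$. *)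

theory Defs
  imports "HOL-Analysis.Analysis"
begin

definition curve_length :: "(real \<Rightarrow> 'a::metric_space) \<Rightarrow> real \<Rightarrow> real \<Rightarrow> ereal" where
  "curve_length \<gamma> a b =
     (SUP (n, t) \<in> {(n, t). mono_on {..n} t \<and> t ` {..n} \<subseteq> {a..b}}.
        ereal (\<Sum>i<n. dist (\<gamma> (t i)) (\<gamma> (t (Suc i)))))"

(* The infimum is taken in ereal, where the empty infimum is \<infinity>; since dist is finite, the axiom
   also says that any two points are joined by a rectifiable path. *)
class length_space = metric_space +
  assumes dist_eq_INF_curve_length:
    "ereal (dist x y) =
       (INF \<gamma> \<in> {\<gamma>. path \<gamma> \<and> pathstart \<gamma> = x \<and> pathfinish \<gamma> = y}. curve_length \<gamma> 0 1)"

(* A pair (s, t) in D stands for the interval from s to t. *)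
definition abs_continuous_curve_on :: "real \<Rightarrow> real \<Rightarrow> (real \<Rightarrow> 'a::metric_space) \<Rightarrow> bool" where
  "abs_continuous_curve_on a b \<xi> \<longleftrightarrow>
     (\<forall>\<epsilon>>0. \<exists>\<delta>>0. \<forall>D. finite D \<and> (\<forall>(s, t) \<in> D. a \<le> s \<and> s \<le> t \<and> t \<le> b)
        \<and> pairwise (\<lambda>p q. disjnt {fst p<..<snd p} {fst q<..<snd q}) D
        \<and> (\<Sum>(s, t) \<in> D. t - s) < \<delta>
        \<longrightarrow> (\<Sum>(s, t) \<in> D. dist (\<xi> s) (\<xi> t)) < \<epsilon>)"

(* For an absolutely continuous curve the difference quotient converges for almost every t, so
   that the upper limit agrees almost everywhere with the usual metric derivative. *)
definition metric_speed :: "(real \<Rightarrow> 'a::metric_space) \<Rightarrow> real \<Rightarrow> ereal" where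
  "metric_speed \<xi> t = Limsup (at t) (\<lambda>s. ereal (dist (\<xi> s) (\<xi> t) / \<bar>s - t\<bar>))"

(* On the whole line, absolute continuity is understood on every compact interval; together with
   the bound on the speed these are exactly the 1-Lipschitz curves. *)
definition admissible_curves :: "'a::metric_space set \<Rightarrow> 'a \<Rightarrow> (real \<Rightarrow> 'a) set" where
  "admissible_curves \<Omega> x =
     {\<xi>. range \<xi> \<subseteq> \<Omega> \<and> (\<forall>a b. abs_continuous_curve_on a b \<xi>)
        \<and> (AE t in lborel. metric_speed \<xi> t \<le> 1) \<and> \<xi> 0 = x}"

definition upper_semicontinuous_on :: "'a::topological_space set \<Rightarrow> ('a \<Rightarrow> real) \<Rightarrow> bool" where
  "upper_semicontinuous_on \<Omega> u \<longleftrightarrow>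
     (\<forall>x\<in>\<Omega>. \<forall>c>u x. \<forall>\<^sub>F y in at x within \<Omega>. u y < c)"

definition c_subsolution ::
  "'a::metric_space set \<Rightarrow> ('a \<Rightarrow> real) \<Rightarrow> ('a \<Rightarrow> real) \<Rightarrow> bool" where
  "c_subsolution \<Omega> f u \<longleftrightarrow>
     upper_semicontinuous_on \<Omega> u \<and>
     (\<forall>x\<in>\<Omega>. \<forall>\<xi> \<in> admissible_curves \<Omega> x. \<forall>\<phi> :: real \<Rightarrow> real.
        \<phi> C1_differentiable_on UNIV \<and>
        (\<forall>\<^sub>F t in nhds 0. u (\<xi> t) - \<phi> t \<le> u (\<xi> 0) - \<phi> 0)
        \<longrightarrow> \<bar>deriv \<phi> 0\<bar> \<le> f x)"

definition Lip_loc :: "'a::metric_space set \<Rightarrow> ('a \<Rightarrow> real) set" where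
  "Lip_loc \<Omega> = {u. \<forall>x\<in>\<Omega>. \<exists>r>0. \<exists>L. L-lipschitz_on (ball x r \<inter> \<Omega>) u}"

(* At an isolated point of \<Omega> the filter is trivial and the value is -\<infinity>. In a length space and for
   open \<Omega> this occurs only if the space is a single point. *)
definition descending_slope :: "'a::metric_space set \<Rightarrow> ('a \<Rightarrow> real) \<Rightarrow> 'a \<Rightarrow> ereal" where
  "descending_slope \<Omega> u x =
     Limsup (at x within \<Omega>) (\<lambda>y. ereal (max (u x - u y) 0 / dist x y))"

definition Monge_subsolution ::
  "'a::metric_space set \<Rightarrow> ('a \<Rightarrow> real) \<Rightarrow> ('a \<Rightarrow> real) \<Rightarrow> bool" where
  "Monge_subsolution \<Omega> f u \<longleftrightarrow>
     u \<in> Lip_loc \<Omega> \<and> (\<forall>x\<in>\<Omega>. descending_slope \<Omega> u x \<le> ereal (f x))"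

end

theory Submission
  imports Defs
begin

text \<open>Admissible curves are exactly the 1-Lipschitz curves. If \<open>u\<close> is a c-subsolution and \<open>f \<le> M\<close> near \<open>x\<close>,
  then along any 1-Lipschitz curve near \<open>x\<close> the function \<open>u\<close> is a one-dimensional viscosity subsolution
  with slope bound \<open>M\<close>, so it grows at rate at most \<open>M\<close>. Almost length-minimising curves, reparametrised to be
  1-Lipschitz, join nearby points, whence \<open>u\<close> is \<open>M\<close>-Lipschitz near \<open>x\<close>; now let \<open>M\<close> decrease to \<open>f x\<close>.
  Conversely, if \<open>\<phi>\<close> touches \<open>u \<circ> \<xi>\<close> from above at \<open>0\<close>, then moving in the direction in which \<open>\<phi>\<close>
  decreases shows that \<open>u\<close> decreases from \<open>x\<close> at rate at least \<open>\<bar>\<phi>' 0\<bar>\<close>.\<close>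

section \<open>Absolutely continuous curves of bounded metric speed\<close>

lemma tagged_division_of_real_intervalD:
  fixes a b :: real
  assumes "p tagged_division_of {a..b}" and "(x, K) \<in> p"
  shows "K = {Inf K..Sup K}" "Inf K \<le> x" "x \<le> Sup K" "a \<le> Inf K" "Sup K \<le> b"
proof -
  obtain c d where K: "K = {c..d}"
    using tagged_division_ofD(4)[OF assms] by auto
  have "x \<in> K" "K \<subseteq> {a..b}"
    using tagged_division_ofD(2,3)[OF assms] by auto
  with K show "K = {Inf K..Sup K}" "Inf K \<le> x" "x \<le> Sup K" "a \<le> Inf K" "Sup K \<le> b"
    by auto
qed

text \<open>The open cells are pairwise disjoint and lie in \<open>T\<close>, so their total length
  is the measure of their union, which is at most that of \<open>T\<close>. This is used for the
  cells whose tags lie in the exceptional null set.\<close>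

lemma tagged_division_sum_length_lt:
  fixes p :: "(real \<times> real set) set"
  assumes p: "p tagged_division_of {a..b}" and q: "q \<subseteq> p"
    and T: "open T" "emeasure lborel T < ennreal \<delta>" "\<And>x K. (x, K) \<in> q \<Longrightarrow> K \<subseteq> T"
  shows "(\<Sum>(x, K)\<in>q. Sup K - Inf K) < \<delta>"
proof -
  let ?A = "\<lambda>(x, K). {Inf K<..<Sup K} :: real set"
  have fin: "finite q"
    using tagged_division_ofD(1)[OF p] q finite_subset by blast
  have K: "K = {Inf K..Sup K}" "Inf K \<le> Sup K" if "(x, K) \<in> q" for x K
    using tagged_division_of_real_intervalD[OF p, of x K] that q by auto
  have int: "?A z = interior (snd z)" if "z \<in> q" for z
  proof -
    obtain x K where z: "z = (x, K)" by force
    have "interior K = interior {Inf K..Sup K}"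
      using K(1)[of x K] that z by (intro arg_cong[where f = interior]) simp
    then show ?thesis by (simp add: z)
  qed
  have disj: "disjoint_family_on ?A q"
    unfolding disjoint_family_on_def
  proof (intro ballI impI)
    fix y z assume "y \<in> q" "z \<in> q" "y \<noteq> z"
    then show "?A y \<inter> ?A z = {}"
      using tagged_division_ofD(5)[OF p, of "fst y" "snd y" "fst z" "snd z"] q
      unfolding int[OF \<open>y \<in> q\<close>] int[OF \<open>z \<in> q\<close>] by (auto simp: prod_eq_iff)
  qed
  have sub: "(\<Union>z\<in>q. ?A z) \<subseteq> T"
  proof (rule UN_least)
    fix z assume z: "z \<in> q"
    then show "?A z \<subseteq> T"
      using T(3)[of "fst z" "snd z"] interior_subset[of "snd z"] unfolding int[OF z] by simp
  qed
  then have em: "emeasure lborel (\<Union>z\<in>q. ?A z) < ennreal \<delta>"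
    using emeasure_mono[OF sub, of lborel] T(1,2) by (auto intro: order_le_less_trans)
  have "(\<Sum>(x, K)\<in>q. Sup K - Inf K) = (\<Sum>z\<in>q. measure lborel (?A z))"
    using K by (intro sum.cong) (auto split: prod.split)
  also have "\<dots> = measure lborel (\<Union>z\<in>q. ?A z)"
    using K(2) by (intro measure_finite_Union[symmetric] fin disj) (auto simp: emeasure_lborel_Ioo)
  also have "\<dots> < \<delta>"
    using em by (subst (asm) emeasure_eq_ennreal_measure)
      (use em in \<open>auto simp: ennreal_less_iff top_unique\<close>)
  finally show ?thesis .
qed

text \<open>A Henstock--Kurzweil style argument: the difference quotient is controlled by a gauge at the
  good tags, while the intervals with tags in the exceptional null set are contained in an open set
  of small measure, so that absolute continuity applies to them.\<close>

lemma abs_continuous_curve_dist_le: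
  fixes \<xi> :: "real \<Rightarrow> 'a::metric_space"
  assumes ac: "abs_continuous_curve_on a b \<xi>"
    and speed: "AE t in lborel. metric_speed \<xi> t \<le> ereal L"
    and "0 \<le> L" "a \<le> b"
  shows "dist (\<xi> a) (\<xi> b) \<le> L * (b - a)"
proof -
  have approx: "dist (\<xi> a) (\<xi> b) \<le> (L + \<epsilon>) * (b - a) + \<epsilon>" if "\<epsilon> > 0" for \<epsilon>
  proof -
    obtain \<delta> where "\<delta> > 0" and \<delta>: "\<forall>D. finite D \<and> (\<forall>(s, t) \<in> D. a \<le> s \<and> s \<le> t \<and> t \<le> b)
        \<and> pairwise (\<lambda>p q. disjnt {fst p<..<snd p} {fst q<..<snd q}) D \<and> (\<Sum>(s, t) \<in> D. t - s) < \<delta>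
        \<longrightarrow> (\<Sum>(s, t) \<in> D. dist (\<xi> s) (\<xi> t)) < \<epsilon>"
      using ac[unfolded abs_continuous_curve_on_def, rule_format, OF \<open>\<epsilon> > 0\<close>] by (elim exE conjE)
    obtain N where N: "{t. \<not> metric_speed \<xi> t \<le> ereal L} \<subseteq> N" "emeasure lborel N = 0" "N \<in> sets lborel"
      using AE_E[OF speed] by auto
    obtain T where T: "open T" "N \<subseteq> T" "emeasure lborel (T - N) < ennreal \<delta>"
      using outer_regular_lborel[of N \<delta>] N \<open>\<delta> > 0\<close> by auto
    have "emeasure lborel T < ennreal \<delta>"
      using T N emeasure_Diff_null_set[of N lborel T] by (auto simp: null_sets_def)
    have "\<exists>r>0. (t \<in> N \<longrightarrow> ball t r \<subseteq> T) \<and>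
        (t \<notin> N \<longrightarrow> (\<forall>s\<in>ball t r. dist (\<xi> s) (\<xi> t) \<le> (L + \<epsilon>) * \<bar>s - t\<bar>))" for t
    proof (cases "t \<in> N")
      case True
      with T show ?thesis by (metis openE subsetD)
    next
      case False
      then have "metric_speed \<xi> t \<le> ereal L"
        using N by auto
      also have "\<dots> < ereal (L + \<epsilon>)"
        using \<open>\<epsilon> > 0\<close> by simp
      finally have "\<forall>\<^sub>F s in at t. ereal (dist (\<xi> s) (\<xi> t) / \<bar>s - t\<bar>) < ereal (L + \<epsilon>)"
        unfolding metric_speed_def by (rule Limsup_lessD)
      then obtain r where r: "r > 0" "\<And>s. s \<noteq> t \<Longrightarrow> dist s t < r \<Longrightarrow> dist (\<xi> s) (\<xi> t) / \<bar>s - t\<bar> < L + \<epsilon>"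
        by (auto simp: eventually_at)
      have "dist (\<xi> s) (\<xi> t) \<le> (L + \<epsilon>) * \<bar>s - t\<bar>" if "s \<in> ball t r" for s
        using r(2)[of s] that by (cases "s = t") (auto simp: dist_commute field_simps)
      with r(1) False show ?thesis by auto
    qed
    then obtain r where r: "\<And>t. r t > 0" "\<And>t. t \<in> N \<Longrightarrow> ball t (r t) \<subseteq> T"
      "\<And>t s. t \<notin> N \<Longrightarrow> s \<in> ball t (r t) \<Longrightarrow> dist (\<xi> s) (\<xi> t) \<le> (L + \<epsilon>) * \<bar>s - t\<bar>"
      by metis
    have "gauge (\<lambda>t. ball t (r t))"
      using r(1) by (simp add: gauge_def)
    then obtain p where p: "p tagged_division_of {a..b}" and fine: "(\<lambda>t. ball t (r t)) fine p"
      using fine_division_exists_real by blast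
    have fin: "finite p"
      using p by auto
    note pD = tagged_division_of_real_intervalD[OF p]
    \<comment> \<open>The condition \<open>Inf K < Sup K\<close> gives every selected cell a
      nonempty interior; its midpoint then shows that \<open>e\<close> is injective on
      \<open>q\<close>, so that sums over \<open>q\<close> become sums over a set of endpoint pairs.
      Degenerate cells contribute zero to all sums.\<close>
    define q where "q = {(x, K) \<in> p. x \<in> N \<and> Inf K < Sup K}"
    have qp: "q \<subseteq> p"
      by (auto simp: q_def)
    define e where "e = (\<lambda>(x::real, K::real set). (Inf K, Sup K))"
    have int: "interior K = {Inf K<..<Sup K}" if "(x, K) \<in> p" for x K
    proof -
      have "interior K = interior {Inf K..Sup K}"
        using pD(1)[OF that] by (intro arg_cong[where f = interior]) simp
      then show ?thesis by simp
    qed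
    have disj: "{Inf K<..<Sup K} \<inter> {Inf K'<..<Sup K'} = {}"
      if "(x, K) \<in> p" "(x', K') \<in> p" "(x, K) \<noteq> (x', K')" for x K x' K'
      using tagged_division_ofD(5)[OF p that] int that by metis
    have inj: "inj_on e q"
    proof (rule inj_onI)
      fix y z assume yz: "y \<in> q" "z \<in> q" "e y = e z"
      obtain x K x' K' where eq: "y = (x, K)" "z = (x', K')"
        by (cases y, cases z)
      have "(Inf K + Sup K) / 2 \<in> {Inf K<..<Sup K} \<inter> {Inf K'<..<Sup K'}"
        using yz eq by (auto simp: q_def e_def)
      then show "y = z"
        using disj[of x K x' K'] yz eq qp by blast
    qed
    have small: "(\<Sum>(x, K)\<in>q. Sup K - Inf K) < \<delta>"
    proof (rule tagged_division_sum_length_lt[OF p qp T(1) \<open>emeasure lborel T < ennreal \<delta>\<close>])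
      fix x K assume "(x, K) \<in> q"
      then show "K \<subseteq> T"
        using fine r(2)[of x] by (fastforce simp: q_def fine_def)
    qed
    have bad: "(\<Sum>(x, K)\<in>q. dist (\<xi> (Inf K)) (\<xi> (Sup K))) < \<epsilon>"
    proof -
      have "(\<Sum>(s, t) \<in> e ` q. dist (\<xi> s) (\<xi> t)) < \<epsilon>"
      proof (intro \<delta>[THEN spec, THEN mp] conjI)
        show "finite (e ` q)"
          using fin qp finite_subset by blast
        show "\<forall>(s, t) \<in> e ` q. a \<le> s \<and> s \<le> t \<and> t \<le> b"
          using pD qp by (fastforce simp: e_def q_def)
        show "pairwise (\<lambda>p q. disjnt {fst p<..<snd p} {fst q<..<snd q}) (e ` q)"
          unfolding pairwise_def
        proof (intro ballI impI)
          fix y z assume "y \<in> e ` q" "z \<in> e ` q" "y \<noteq> z"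
          then obtain x K x' K' where *: "(x, K) \<in> q" "(x', K') \<in> q" "y = (Inf K, Sup K)" "z = (Inf K', Sup K')"
            by (auto simp: e_def)
          then show "disjnt {fst y<..<snd y} {fst z<..<snd z}"
            using disj[of x K x' K'] qp \<open>y \<noteq> z\<close> by (fastforce simp: disjnt_def)
        qed
        show "(\<Sum>(s, t) \<in> e ` q. t - s) < \<delta>"
          using small by (subst sum.reindex[OF inj]) (simp add: e_def case_prod_unfold)
      qed
      then show ?thesis
        by (subst (asm) sum.reindex[OF inj]) (simp add: e_def case_prod_unfold)
    qed
    define d where "d = (\<lambda>(x::real, K). dist (\<xi> (Inf K)) (\<xi> (Sup K)))"
    define l where "l = (\<lambda>(x::real, K::real set). Sup K - Inf K)"
    \<comment> \<open>Outside \<open>q\<close> a nondegenerate cell has a good tag \<open>x\<close>,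
      and the gauge estimate applies to its two halves left and right of \<open>x\<close>. Cells in
      \<open>q\<close> keep their whole contribution \<open>d z\<close>, to be absorbed by
      \<open>bad\<close>.\<close>
    have good: "d z \<le> (L + \<epsilon>) * l z + (if z \<in> q then d z else 0)"
      if "z \<in> p" for z
    proof (cases "z \<in> q")
      case False
      obtain x K where z: "z = (x, K)" by force
      note K = pD[of x K, OF \<open>z \<in> p\<close>[unfolded z]]
      show ?thesis
      proof (cases "Inf K < Sup K")
        case True
        then have "x \<notin> N"
          using False that z by (auto simp: q_def)
        have "Inf K \<in> {Inf K..Sup K}" "Sup K \<in> {Inf K..Sup K}"
          using True by simp_all
        then have "Inf K \<in> K" "Sup K \<in> K"
          using K(1) by simp_all
        moreover have "K \<subseteq> ball x (r x)"
          using fine that z by (auto simp: fine_def)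
        ultimately have "dist (\<xi> (Inf K)) (\<xi> x) \<le> (L + \<epsilon>) * (x - Inf K)"
            "dist (\<xi> (Sup K)) (\<xi> x) \<le> (L + \<epsilon>) * (Sup K - x)"
          using r(3)[OF \<open>x \<notin> N\<close>, of "Inf K"] r(3)[OF \<open>x \<notin> N\<close>, of "Sup K"] K by auto
        then have "d z \<le> (L + \<epsilon>) * (x - Inf K) + (L + \<epsilon>) * (Sup K - x)"
          using dist_triangle2[of "\<xi> (Inf K)" "\<xi> (Sup K)" "\<xi> x"] by (simp add: d_def z)
        then show ?thesis
          using False by (simp add: l_def z algebra_simps)
      next
        case False': False
        then have "Inf K = Sup K"
          using K by linarith
        then show ?thesis
          using False by (simp add: d_def l_def z)
      qed
    next
      case True
      then show ?thesis
        using \<open>0 \<le> L\<close> \<open>\<epsilon> > 0\<close> by (auto simp: q_def l_def)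
    qed
    have ltot: "(\<Sum>z\<in>p. l z) = b - a"
      using additive_tagged_division_1[OF \<open>a \<le> b\<close> p, of "\<lambda>t. t"] by (simp add: l_def)
    \<comment> \<open>Differences of \<open>\<xi>\<close> make no sense in a metric space, so the
      telescoping is done for the real function \<open>\<lambda>t. dist (\<xi> a) (\<xi> t)\<close>,
      whose increments over cells are bounded by \<open>d\<close>.\<close>
    have "dist (\<xi> a) (\<xi> b) = (\<Sum>(x, K)\<in>p. dist (\<xi> a) (\<xi> (Sup K)) - dist (\<xi> a) (\<xi> (Inf K)))"
      using additive_tagged_division_1[OF \<open>a \<le> b\<close> p, of "\<lambda>t. dist (\<xi> a) (\<xi> t)"] by simp
    also have "\<dots> \<le> (\<Sum>z\<in>p. d z)"
      by (intro sum_mono) (auto simp: d_def algebra_simps dist_triangle)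
    also have "\<dots> \<le> (\<Sum>z\<in>p. (L + \<epsilon>) * l z + (if z \<in> q then d z else 0))"
      by (intro sum_mono good)
    also have "\<dots> = (L + \<epsilon>) * (b - a) + (\<Sum>z\<in>q. d z)"
      using fin qp by (simp add: sum.distrib sum.inter_restrict[symmetric] Int_absorb1 ltot
          flip: sum_distrib_left)
    also have "\<dots> \<le> (L + \<epsilon>) * (b - a) + \<epsilon>"
      using bad by (simp add: d_def)
    finally show ?thesis .
  qed
  show ?thesis
  proof (rule field_le_epsilon)
    fix e :: real assume "e > 0"
    show "dist (\<xi> a) (\<xi> b) \<le> L * (b - a) + e"
    proof -
      \<comment> \<open>The total error \<open>\<epsilon> * (b - a) + \<epsilon>\<close> is then
        exactly \<open>e\<close>.\<close>
      define \<epsilon> where "\<epsilon> = e / (b - a + 1)"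
      have "\<epsilon> > 0" "\<epsilon> * (b - a + 1) = e"
        using \<open>a \<le> b\<close> \<open>e > 0\<close> by (simp_all add: \<epsilon>_def)
      with approx[of \<epsilon>] show ?thesis
        by (simp add: algebra_simps)
    qed
  qed
qed

section \<open>Curve length and Lipschitz reparametrisation\<close>

lemma curve_length_nonneg:
  assumes "a \<le> b"
  shows "0 \<le> curve_length \<gamma> a b"
proof -
  \<comment> \<open>The trivial partition with \<open>n = 0\<close> has an empty sum. It is
    available because \<open>a \<le> b\<close>; an empty supremum would be minus infinity.\<close>
  have "ereal (\<Sum>i<0. dist (\<gamma> a) (\<gamma> a)) \<le> curve_length \<gamma> a b"
    unfolding curve_length_def
    using assms by (intro SUP_upper2[of "(0, \<lambda>_. a)"]) (auto simp: mono_on_def)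
  then show ?thesis by (simp add: zero_ereal_def)
qed

text \<open>A partition of \<open>{a..t}\<close> followed by the two points \<open>t\<close> and
  \<open>t'\<close> is a partition of \<open>{a..t'}\<close>. Hence the increments of the length,
  where it is finite, dominate distances along \<open>\<gamma>\<close>, as the reparametrisation
  requires of \<open>S\<close>.\<close>

lemma curve_length_add_dist_le:
  assumes "t \<le> t'" "a \<le> t"
  shows "curve_length \<gamma> a t + ereal (dist (\<gamma> t) (\<gamma> t')) \<le> curve_length \<gamma> a t'"
proof -
  have "curve_length \<gamma> a t \<le> curve_length \<gamma> a t' - ereal (dist (\<gamma> t) (\<gamma> t'))"
    unfolding curve_length_def[of \<gamma> a t]
  proof (rule SUP_least)
    fix z assume "z \<in> {(n :: nat, p). mono_on {..n} p \<and> p ` {..n} \<subseteq> {a..t}}"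
    then obtain n p where z: "z = (n, p)" and p: "mono_on {..n} p" "\<And>i. i \<le> n \<Longrightarrow> a \<le> p i \<and> p i \<le> t"
      by (auto simp: image_subset_iff)
    define p' where "p' i = (if i \<le> n then p i else if i = Suc n then t else t')" for i :: nat
    have "mono_on {..n + 2} p'"
      using p assms by (auto simp: mono_on_def p'_def intro: order_trans)
    moreover have "p' ` {..n + 2} \<subseteq> {a..t'}"
      using p assms by (force simp: p'_def)
    ultimately have "ereal (\<Sum>i<n + 2. dist (\<gamma> (p' i)) (\<gamma> (p' (Suc i)))) \<le> curve_length \<gamma> a t'"
      unfolding curve_length_def by (intro SUP_upper2[of "(n + 2, p')"]) auto
    moreover have "(\<Sum>i<n + 2. dist (\<gamma> (p' i)) (\<gamma> (p' (Suc i)))) =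
        (\<Sum>i<n. dist (\<gamma> (p i)) (\<gamma> (p (Suc i)))) + dist (\<gamma> (p n)) (\<gamma> t) + dist (\<gamma> t) (\<gamma> t')"
      by (simp add: p'_def)
    ultimately have "ereal (\<Sum>i<n. dist (\<gamma> (p i)) (\<gamma> (p (Suc i)))) + ereal (dist (\<gamma> t) (\<gamma> t'))
        \<le> curve_length \<gamma> a t'"
      by (smt (verit) ereal_less_eq(3) order_trans plus_ereal.simps(1) zero_le_dist)
    then show "(case z of (n, t) \<Rightarrow> ereal (\<Sum>i<n. dist (\<gamma> (t i)) (\<gamma> (t (Suc i)))))
        \<le> curve_length \<gamma> a t' - ereal (dist (\<gamma> t) (\<gamma> t'))"
      by (simp add: z ereal_le_minus)
  qed
  then show ?thesis
    by (simp add: ereal_le_minus)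
qed

text \<open>The reparametrisation composes \<open>\<gamma>\<close> with a generalised inverse \<open>\<tau>\<close> of the length function \<open>S\<close>.
  Neither \<open>\<tau>\<close> nor \<open>S\<close> has to be continuous: approximating \<open>\<tau> s\<close> from the right and \<open>\<tau> s'\<close> from the left,
  the increment of \<open>S\<close> is at most \<open>s' - s\<close>, and the limit only uses continuity of \<open>\<gamma>\<close>.\<close>

lemma lipschitz_reparametrization:
  fixes \<gamma> :: "real \<Rightarrow> 'a::metric_space" and S :: "real \<Rightarrow> real"
  assumes cont: "continuous_on {0..1} \<gamma>"
    and S: "\<And>t t'. 0 \<le> t \<Longrightarrow> t \<le> t' \<Longrightarrow> t' \<le> 1 \<Longrightarrow> dist (\<gamma> t) (\<gamma> t') \<le> S t' - S t"
    and S0: "S 0 = 0"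
  obtains \<sigma> where "1-lipschitz_on UNIV \<sigma>" "\<And>s. s \<le> 0 \<Longrightarrow> \<sigma> s = \<gamma> 0" "\<And>s. S 1 \<le> s \<Longrightarrow> \<sigma> s = \<gamma> 1"
proof -
  \<comment> \<open>The truncation \<open>max s 0\<close> keeps \<open>0\<close> in
    \<open>A s\<close> for negative \<open>s\<close> too, so the supremum is always over a nonempty
    set and \<open>\<tau>\<close> is constant on the negative half-line.\<close>
  define A where "A s = {t \<in> {0..1}. S t \<le> max s 0}" for s
  define \<tau> where "\<tau> s = Sup (A s)" for s
  have mono: "S t \<le> S t'" if "0 \<le> t" "t \<le> t'" "t' \<le> 1" for t t'
    using S[OF that] by (meson diff_ge_0_iff_ge order_trans zero_le_dist)
  have A0: "0 \<in> A s" for s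
    by (auto simp: A_def S0)
  have bdd: "bdd_above (A s)" for s
    by (auto simp: A_def bdd_above_def intro: exI[of _ 1])
  have \<tau>01: "0 \<le> \<tau> s" "\<tau> s \<le> 1" for s
  proof -
    show "0 \<le> \<tau> s"
      unfolding \<tau>_def by (rule cSup_upper[OF A0 bdd])
    show "\<tau> s \<le> 1"
      unfolding \<tau>_def by (intro cSup_least) (use A0[of s] in blast, simp add: A_def)
  qed
  have above: "max s 0 < S t" if "\<tau> s < t" "t \<le> 1" for s t
    using cSup_upper[of t "A s"] bdd[of s] that \<tau>01(1)[of s] by (force simp: A_def \<tau>_def)
  have below: "S t \<le> max s 0" if t: "0 \<le> t" "t < \<tau> s" for s t
  proof -
    obtain t' where "t' \<in> A s" "t < t'"
      using less_cSupE[of t "A s"] A0[of s] t(2) unfolding \<tau>_def by blast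
    then show ?thesis
      using mono[of t t'] t by (auto simp: A_def)
  qed
  have close: "\<exists>r>0. \<forall>t\<in>{0..1}. dist t x < r \<longrightarrow> dist (\<gamma> t) (\<gamma> x) < e" if "e > 0" "x \<in> {0..1}" for e x
    using cont that unfolding continuous_on_iff by blast
  have step: "dist (\<gamma> (\<tau> s)) (\<gamma> (\<tau> s')) \<le> s' - s" if "s \<le> s'" for s s'
  proof (cases "\<tau> s < \<tau> s'")
    case False
    moreover have "\<tau> s \<le> \<tau> s'"
      unfolding \<tau>_def using that by (intro cSup_subset_mono bdd) (use A0 in blast, auto simp: A_def)
    ultimately show ?thesis using that by simp
  next
    case True
    show ?thesis
    proof (rule field_le_epsilon)
      fix e :: real assume "e > 0"
      obtain r where r: "r > 0" "\<And>t. t \<in> {0..1} \<Longrightarrow> dist t (\<tau> s) < r \<Longrightarrow> dist (\<gamma> t) (\<gamma> (\<tau> s)) < e / 2"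
        using close[of "e / 2" "\<tau> s"] \<open>e > 0\<close> \<tau>01 by auto
      obtain r' where r': "r' > 0" "\<And>t. t \<in> {0..1} \<Longrightarrow> dist t (\<tau> s') < r' \<Longrightarrow> dist (\<gamma> t) (\<gamma> (\<tau> s')) < e / 2"
        using close[of "e / 2" "\<tau> s'"] \<open>e > 0\<close> \<tau>01 by auto
      \<comment> \<open>Small enough for both continuity estimates, and a third of the gap at most,
        so that the shifted points do not cross.\<close>
      define h where "h = min (min r r') (\<tau> s' - \<tau> s) / 3"
      have h: "h > 0" "h < r" "h < r'" "\<tau> s + h \<le> \<tau> s' - h"
        using True r(1) r'(1) by (auto simp: h_def min_def field_simps)
      define t t' where "t = \<tau> s + h" and "t' = \<tau> s' - h"
      have t: "0 \<le> t" "t \<le> t'" "t' \<le> 1" "\<tau> s < t" "t' < \<tau> s'"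
        using h \<tau>01[of s] \<tau>01[of s'] by (auto simp: t_def t'_def)
      have "dist (\<gamma> t) (\<gamma> (\<tau> s)) < e / 2" "dist (\<gamma> t') (\<gamma> (\<tau> s')) < e / 2"
        using r(2)[of t] r'(2)[of t'] t h by (auto simp: t_def t'_def dist_real_def)
      moreover have "dist (\<gamma> t) (\<gamma> t') \<le> max s' 0 - max s 0"
        using S[of t t'] above[of s t] below[of t' s'] t by linarith
      moreover have "max s' 0 - max s 0 \<le> s' - s"
        using that by auto
      ultimately show "dist (\<gamma> (\<tau> s)) (\<gamma> (\<tau> s')) \<le> s' - s + e"
        using dist_triangle[of "\<gamma> (\<tau> s)" "\<gamma> (\<tau> s')" "\<gamma> t"] dist_triangle[of "\<gamma> t" "\<gamma> (\<tau> s')" "\<gamma> t'"]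
        by (simp add: dist_commute)
    qed
  qed
  show thesis
  proof
    show "1-lipschitz_on UNIV (\<gamma> \<circ> \<tau>)"
    proof (rule lipschitz_onI)
      fix x y :: real
      show "dist ((\<gamma> \<circ> \<tau>) x) ((\<gamma> \<circ> \<tau>) y) \<le> 1 * dist x y"
        using step[of x y] step[of y x] by (cases "x \<le> y") (auto simp: dist_real_def dist_commute)
    qed simp
    show "(\<gamma> \<circ> \<tau>) s = \<gamma> 0" if "s \<le> 0" for s
    proof -
      \<comment> \<open>Here \<open>\<tau> s\<close> is positive if \<open>S\<close> vanishes on an
        initial interval. On that interval \<open>\<gamma>\<close> stays at
        \<open>\<gamma> 0\<close>, and continuity carries this over to
        \<open>\<tau> s\<close>.\<close>
      have "dist (\<gamma> (\<tau> s)) (\<gamma> 0) \<le> 0 + e" if "e > 0" for e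
      proof -
        obtain r where r: "r > 0" "\<And>t. t \<in> {0..1} \<Longrightarrow> dist t (\<tau> s) < r \<Longrightarrow> dist (\<gamma> t) (\<gamma> (\<tau> s)) < e"
          using close[of e "\<tau> s"] \<open>e > 0\<close> \<tau>01 by auto
        define t where "t = max 0 (\<tau> s - r / 2)"
        have t: "t \<in> {0..1}" "dist t (\<tau> s) < r" "t = 0 \<or> t < \<tau> s"
          using r(1) \<tau>01[of s] by (auto simp: t_def dist_real_def)
        have "dist (\<gamma> 0) (\<gamma> t) \<le> 0"
          using S[of 0 t] below[of t s] t \<open>s \<le> 0\<close> S0 by (smt (verit) atLeastAtMost_iff diff_0_right dist_self)
        then show ?thesis
          using r(2)[OF t(1,2)] by (simp add: dist_commute)
      qed
      then have "dist (\<gamma> (\<tau> s)) (\<gamma> 0) \<le> 0"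
        by (rule field_le_epsilon)
      then show ?thesis by simp
    qed
    show "(\<gamma> \<circ> \<tau>) s = \<gamma> 1" if "S 1 \<le> s" for s
    proof -
      have "1 \<in> A s"
        using that by (auto simp: A_def)
      then have "\<tau> s = 1"
        using cSup_upper[OF _ bdd, of 1 s] \<tau>01(2)[of s] by (simp add: \<tau>_def)
      then show ?thesis by simp
    qed
  qed
qed

text \<open>The distance is an infimum of lengths, so some path from \<open>y\<close> to
  \<open>z\<close> is shorter than \<open>l\<close>; it is reparametrised by its length. The
  constant continuation on both sides defines the curve on the whole line, as admissibility
  demands.\<close>

lemma length_space_lipschitz_curve:
  fixes y z :: "'a::length_space"
  assumes "dist y z < l"
  obtains \<sigma> where "1-lipschitz_on UNIV \<sigma>" "\<And>s. s \<le> 0 \<Longrightarrow> \<sigma> s = y" "\<And>s. l \<le> s \<Longrightarrow> \<sigma> s = z"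
proof -
  have "(INF \<gamma> \<in> {\<gamma>. path \<gamma> \<and> pathstart \<gamma> = y \<and> pathfinish \<gamma> = z}. curve_length \<gamma> 0 1) < ereal l"
    using assms dist_eq_INF_curve_length[of y z] by (metis less_ereal.simps(1))
  then obtain \<gamma> where \<gamma>: "path \<gamma>" "\<gamma> 0 = y" "\<gamma> 1 = z" and len: "curve_length \<gamma> 0 1 < ereal l"
    by (auto simp: INF_less_iff pathstart_def pathfinish_def)
  \<comment> \<open>Subtracting the length over the degenerate interval gives \<open>S 0 = 0\<close>
    directly.\<close>
  define S where "S t = real_of_ereal (curve_length \<gamma> 0 t) - real_of_ereal (curve_length \<gamma> 0 0)" for t
  have fin: "\<bar>curve_length \<gamma> 0 t\<bar> \<noteq> \<infinity>" if "0 \<le> t" "t \<le> 1" for t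
    using curve_length_add_dist_le[OF that(2,1), of \<gamma>] curve_length_nonneg[OF that(1), of \<gamma>] len
    by (cases "curve_length \<gamma> 0 t"; cases "curve_length \<gamma> 0 1") auto
  have S: "dist (\<gamma> t) (\<gamma> t') \<le> S t' - S t" if "0 \<le> t" "t \<le> t'" "t' \<le> 1" for t t'
    using curve_length_add_dist_le[OF that(2,1), of \<gamma>] fin[of t] fin[of t'] that
    by (cases "curve_length \<gamma> 0 t"; cases "curve_length \<gamma> 0 t'") (auto simp: S_def)
  obtain \<sigma> where \<sigma>: "1-lipschitz_on UNIV \<sigma>" "\<And>s. s \<le> 0 \<Longrightarrow> \<sigma> s = \<gamma> 0" "\<And>s. S 1 \<le> s \<Longrightarrow> \<sigma> s = \<gamma> 1"
    using lipschitz_reparametrization[of \<gamma> S] S \<gamma>(1) by (auto simp: path_def S_def)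
  have "S 1 \<le> l"
    using len fin[of 1] curve_length_nonneg[of 0 0 \<gamma>]
    by (cases "curve_length \<gamma> 0 1"; cases "curve_length \<gamma> 0 0") (auto simp: S_def)
  with \<sigma> show thesis
    using that \<gamma> by (metis order_trans)
qed

section \<open>Admissible curves as 1-Lipschitz curves\<close>

text \<open>One direction is the distance estimate for absolutely continuous curves with
  \<open>L = 1\<close>. For the other, a 1-Lipschitz curve is absolutely continuous with
  \<open>\<delta> = \<epsilon>\<close>, and all its difference quotients are at most
  \<open>1\<close>.\<close>

lemma admissible_curves_iff:
  "\<xi> \<in> admissible_curves \<Omega> x \<longleftrightarrow> range \<xi> \<subseteq> \<Omega> \<and> 1-lipschitz_on UNIV \<xi> \<and> \<xi> 0 = x"
proof -
  have "1-lipschitz_on UNIV \<xi>"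
    if ac: "\<And>a b. abs_continuous_curve_on a b \<xi>" and speed: "AE t in lborel. metric_speed \<xi> t \<le> 1"
  proof (rule lipschitz_onI)
    fix s t :: real
    have "dist (\<xi> s) (\<xi> t) \<le> 1 * (t - s)" if "s \<le> t" for s t
      using abs_continuous_curve_dist_le[OF ac _ _ that, of 1] speed by (simp add: one_ereal_def)
    from this[of s t] this[of t s] show "dist (\<xi> s) (\<xi> t) \<le> 1 * dist s t"
      by (cases "s \<le> t") (auto simp: dist_real_def dist_commute)
  qed simp
  moreover have "abs_continuous_curve_on a b \<xi>" "metric_speed \<xi> t \<le> 1"
    if lip: "1-lipschitz_on UNIV \<xi>" for a b t
  proof -
    have le: "dist (\<xi> s) (\<xi> t) \<le> \<bar>s - t\<bar>" for s t
      using lipschitz_onD[OF lip, of s t] by (simp add: dist_real_def)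
    show "abs_continuous_curve_on a b \<xi>"
      unfolding abs_continuous_curve_on_def
    proof (intro allI impI)
      fix \<epsilon> :: real assume "\<epsilon> > 0"
      moreover have "(\<Sum>(s, t) \<in> D. dist (\<xi> s) (\<xi> t)) \<le> (\<Sum>(s, t) \<in> D. t - s)"
        if "\<forall>(s, t) \<in> D. a \<le> s \<and> s \<le> t \<and> t \<le> b" for D
      proof (rule sum_mono)
        fix z assume "z \<in> D"
        then show "(case z of (s, t) \<Rightarrow> dist (\<xi> s) (\<xi> t)) \<le> (case z of (s, t) \<Rightarrow> t - s)"
          using that le[of "fst z" "snd z"] by (auto split: prod.splits)
      qed
      ultimately show "\<exists>\<delta>>0. \<forall>D. finite D \<and> (\<forall>(s, t) \<in> D. a \<le> s \<and> s \<le> t \<and> t \<le> b)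
          \<and> pairwise (\<lambda>p q. disjnt {fst p<..<snd p} {fst q<..<snd q}) D \<and> (\<Sum>(s, t) \<in> D. t - s) < \<delta>
          \<longrightarrow> (\<Sum>(s, t) \<in> D. dist (\<xi> s) (\<xi> t)) < \<epsilon>"
        by (intro exI[of _ \<epsilon>]) (meson order_le_less_trans)
    qed
    show "metric_speed \<xi> t \<le> 1"
      unfolding metric_speed_def
    proof (intro Limsup_bounded always_eventually allI)
      fix s
      \<comment> \<open>At \<open>s = t\<close> the quotient is \<open>0\<close> by the convention
        for division by zero, so the bound holds for every \<open>s\<close>.\<close>
      show "ereal (dist (\<xi> s) (\<xi> t) / \<bar>s - t\<bar>) \<le> 1"
        using le[of s t] by (cases "s = t") (auto simp: one_ereal_def divide_le_eq)
    qed
  qed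
  ultimately show ?thesis
    unfolding admissible_curves_def by auto
qed

section \<open>From c-subsolutions to Monge subsolutions\<close>

text \<open>The slope of the test function exceeds \<open>M\<close> everywhere, and its exponential part, small at \<open>b\<close> but
  large at \<open>b + 1\<close>, forces \<open>w - \<phi>\<close> to have an interior maximum.\<close>

lemma growth_le_if_test_slope_le:
  fixes w :: "real \<Rightarrow> real"
  assumes cont: "continuous_on UNIV w" and "a \<le> b"
    and test: "\<And>\<phi> \<phi>' t\<^sub>0. \<lbrakk>\<And>t. (\<phi> has_real_derivative \<phi>' t) (at t); continuous_on UNIV \<phi>';
        \<forall>\<^sub>F t in nhds t\<^sub>0. w t - \<phi> t \<le> w t\<^sub>0 - \<phi> t\<^sub>0\<rbrakk> \<Longrightarrow> \<phi>' t\<^sub>0 \<le> M"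
  shows "w b - w a \<le> M * (b - a)"
proof (rule ccontr)
  \<comment> \<open>Half of the excess over the claimed growth: the test function spends one half at
    \<open>b\<close>, and the other half remains as \<open>h b = c\<close>.\<close>
  define c where "c = (w b - w a - M * (b - a)) / 2"
  assume "\<not> ?thesis"
  then have "c > 0"
    by (simp add: c_def)
  define R where "R = w (b + 1) - w a - M * (b + 1 - a)"
  \<comment> \<open>This gives \<open>R \<le> c * N \<le> c * exp N\<close>, hence
    \<open>h (b + 1) \<le> 0\<close>. The summand \<open>1\<close> makes \<open>N\<close> positive,
    so that the slope of \<open>\<phi>\<close> exceeds \<open>M\<close> strictly.\<close>
  define N where "N = \<bar>R\<bar> / c + 1"
  have "N > 0"
    using \<open>c > 0\<close> by (simp add: N_def add_nonneg_pos)
  have "c * N = \<bar>R\<bar> + c"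
    using \<open>c > 0\<close> by (simp add: N_def field_simps)
  then have "R \<le> c * N"
    using \<open>c > 0\<close> by linarith
  define \<phi> where "\<phi> t = M * (t - a) + c * exp (N * (t - b))" for t
  define \<phi>' where "\<phi>' t = M + c * (exp (N * (t - b)) * N)" for t
  define h where "h t = w t - w a - \<phi> t" for t
  have "continuous_on {a..b + 1} h"
    unfolding h_def \<phi>_def by (intro continuous_intros continuous_on_subset[OF cont]) auto
  then obtain t\<^sub>0 where t0: "t\<^sub>0 \<in> {a..b + 1}" "\<And>t. t \<in> {a..b + 1} \<Longrightarrow> h t \<le> h t\<^sub>0"
    using continuous_attains_sup[of "{a..b + 1}" h] \<open>a \<le> b\<close> by auto
  have "h b = c"
    by (simp add: h_def \<phi>_def c_def field_simps)
  then have "h t\<^sub>0 > 0"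
    using t0(2)[of b] \<open>a \<le> b\<close> \<open>c > 0\<close> by simp
  moreover have "h a < 0"
    using \<open>c > 0\<close> by (simp add: h_def \<phi>_def)
  moreover have "h (b + 1) \<le> 0"
  proof -
    have "c * N \<le> c * exp N"
      using \<open>c > 0\<close> exp_ge_add_one_self[of N] by (intro mult_left_mono) linarith+
    then show ?thesis
      using \<open>R \<le> c * N\<close> by (simp add: h_def \<phi>_def R_def)
  qed
  ultimately have "t\<^sub>0 \<in> {a<..<b + 1}"
    using t0(1) by (metis atLeastAtMost_iff greaterThanLessThan_iff linorder_not_less order_less_le order_less_trans)
  then have "\<forall>\<^sub>F t in nhds t\<^sub>0. t \<in> {a<..<b + 1}"
    by (intro eventually_nhds_in_open) auto
  then have "\<forall>\<^sub>F t in nhds t\<^sub>0. w t - \<phi> t \<le> w t\<^sub>0 - \<phi> t\<^sub>0"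
    by eventually_elim (use t0(2) in \<open>fastforce simp: h_def\<close>)
  moreover have "(\<phi> has_real_derivative \<phi>' t) (at t)" for t
    unfolding \<phi>_def \<phi>'_def by (auto intro!: derivative_eq_intros)
  moreover have "continuous_on UNIV \<phi>'"
    unfolding \<phi>'_def by (intro continuous_intros)
  ultimately have "\<phi>' t\<^sub>0 \<le> M"
    by (intro test)
  then show False
    using \<open>c > 0\<close> \<open>N > 0\<close> by (simp add: \<phi>'_def mult_le_0_iff)
qed

text \<open>Shifting time by \<open>t\<^sub>0\<close> turns \<open>\<sigma>\<close> into an
  admissible curve through \<open>\<sigma> t\<^sub>0\<close> at time \<open>0\<close>. A test
  function touching at \<open>t\<^sub>0\<close> thus becomes one touching at \<open>0\<close>, with
  slope at most \<open>f (\<sigma> t\<^sub>0) \<le> M\<close>.\<close>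

lemma c_subsolution_growth_along_curve:
  assumes sub: "c_subsolution \<Omega> f u" and cont: "continuous_on \<Omega> u"
    and \<sigma>: "1-lipschitz_on UNIV \<sigma>" "range \<sigma> \<subseteq> \<Omega>" and M: "\<And>t. f (\<sigma> t) \<le> M" and "a \<le> b"
  shows "u (\<sigma> b) - u (\<sigma> a) \<le> M * (b - a)"
proof (rule growth_le_if_test_slope_le[OF _ \<open>a \<le> b\<close>])
  show "continuous_on UNIV (\<lambda>t. u (\<sigma> t))"
    using continuous_on_compose2[OF cont lipschitz_on_continuous_on[OF \<sigma>(1)] \<sigma>(2)] .
next
  fix \<phi> \<phi>' :: "real \<Rightarrow> real" and t\<^sub>0
  assume deriv: "\<And>t. (\<phi> has_real_derivative \<phi>' t) (at t)" and cont': "continuous_on UNIV \<phi>'"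
    and max: "\<forall>\<^sub>F t in nhds t\<^sub>0. u (\<sigma> t) - \<phi> t \<le> u (\<sigma> t\<^sub>0) - \<phi> t\<^sub>0"
  define \<xi> where "\<xi> t = \<sigma> (t\<^sub>0 + t)" for t
  define \<psi> where "\<psi> t = \<phi> (t\<^sub>0 + t)" for t
  have \<psi>': "(\<psi> has_real_derivative \<phi>' (t\<^sub>0 + t)) (at t)" for t
  proof -
    have "((\<lambda>t. t\<^sub>0 + t) has_real_derivative 1) (at t)"
      by (auto intro!: derivative_eq_intros)
    from DERIV_chain2[OF deriv this] show ?thesis
      by (simp add: \<psi>_def[abs_def])
  qed
  have "1-lipschitz_on UNIV \<xi>"
    using \<sigma>(1) by (simp add: lipschitz_on_def \<xi>_def) (metis dist_add_cancel)
  then have "\<xi> \<in> admissible_curves \<Omega> (\<sigma> t\<^sub>0)"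
    using \<sigma>(2) by (auto simp: admissible_curves_iff \<xi>_def)
  moreover have "\<psi> C1_differentiable_on UNIV"
    unfolding C1_differentiable_on_def using \<psi>' cont'
    by (intro exI[of _ "\<lambda>t. \<phi>' (t\<^sub>0 + t)"])
       (auto simp: has_real_derivative_iff_has_vector_derivative intro!: continuous_on_compose2[OF cont'] continuous_intros)
  moreover have "\<forall>\<^sub>F t in nhds 0. u (\<xi> t) - \<psi> t \<le> u (\<xi> 0) - \<psi> 0"
  proof -
    have "filterlim (\<lambda>t. t\<^sub>0 + t) (nhds t\<^sub>0) (nhds 0)"
      by (auto intro!: tendsto_eq_intros filterlim_ident)
    from eventually_compose_filterlim[OF max this] show ?thesis
      by (simp add: \<xi>_def \<psi>_def)
  qed
  moreover have "\<sigma> t\<^sub>0 \<in> \<Omega>"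
    using \<sigma>(2) by auto
  ultimately have "\<bar>deriv \<psi> 0\<bar> \<le> f (\<sigma> t\<^sub>0)"
    using sub unfolding c_subsolution_def by blast
  moreover have "deriv \<psi> 0 = \<phi>' t\<^sub>0"
    using DERIV_imp_deriv[OF \<psi>'[of 0]] by simp
  ultimately show "\<phi>' t\<^sub>0 \<le> M"
    using M[of t\<^sub>0] by linarith
qed

text \<open>Two points of the ball of radius \<open>r\<close> are less than \<open>2 * r\<close>
  apart, and a joining curve of length below \<open>2 * r\<close> stays in the ball of radius
  \<open>3 * r\<close>, where \<open>f\<close> is bounded by \<open>M\<close>. The growth estimate
  along such curves, taken in both directions, gives the Lipschitz bound.\<close>

lemma c_subsolution_lipschitz_on_ball:
  fixes \<Omega> :: "'a::length_space set"
  assumes sub: "c_subsolution \<Omega> f u" and cont: "continuous_on \<Omega> u"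
    and ball: "ball x (3 * r) \<subseteq> \<Omega>" and M: "\<And>y. y \<in> ball x (3 * r) \<Longrightarrow> f y \<le> M" and "0 \<le> M"
  shows "M-lipschitz_on (ball x r) u"
proof -
  have *: "u z - u y \<le> M * dist y z" if y: "y \<in> ball x r" and z: "z \<in> ball x r" for y z
  proof (rule field_le_epsilon)
    fix e :: real assume "e > 0"
    have "dist y z < 2 * r"
      using y z dist_triangle_less_add[of y x r z r] by (simp add: dist_commute)
    \<comment> \<open>The denominator \<open>M + 1\<close> gives \<open>M * \<eta> \<le> e\<close>
      and covers the case \<open>M = 0\<close>.\<close>
    define \<eta> where "\<eta> = e / (M + 1)"
    have "\<eta> > 0" "M * \<eta> \<le> e"
      using \<open>e > 0\<close> \<open>0 \<le> M\<close> by (simp_all add: \<eta>_def field_simps)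
    \<comment> \<open>Above the distance by at most \<open>\<eta>\<close>, and by at most half the
      remaining gap to \<open>2 * r\<close>, so that \<open>l < 2 * r\<close>.\<close>
    define l where "l = dist y z + min \<eta> ((2 * r - dist y z) / 2)"
    have l: "dist y z < l" "l < 2 * r" "l \<le> dist y z + \<eta>"
      using \<open>dist y z < 2 * r\<close> \<open>\<eta> > 0\<close> by (auto simp: l_def min_def field_simps)
    then have "l > 0"
      by (smt (verit) zero_le_dist)
    obtain \<sigma> where \<sigma>: "1-lipschitz_on UNIV \<sigma>" "\<And>s. s \<le> 0 \<Longrightarrow> \<sigma> s = y" "\<And>s. l \<le> s \<Longrightarrow> \<sigma> s = z"
      using length_space_lipschitz_curve[OF l(1)] by blast
    have near: "\<sigma> s \<in> ball x (3 * r)" for s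
    proof -
      \<comment> \<open>Between times \<open>0\<close> and \<open>l\<close> this is the Lipschitz
        bound; outside, the curve rests at \<open>y\<close> or at \<open>z\<close>.\<close>
      have "dist y (\<sigma> s) \<le> l"
        using lipschitz_onD[OF \<sigma>(1), of 0 s] \<sigma>(2)[of 0] \<sigma>(2)[of s] \<sigma>(3)[of s] l(1) \<open>l > 0\<close>
        by (cases "s \<le> 0"; cases "l \<le> s") (auto simp: dist_real_def)
      then show ?thesis
        using dist_triangle[of x "\<sigma> s" y] y l(2) by simp
    qed
    have "u (\<sigma> l) - u (\<sigma> 0) \<le> M * (l - 0)"
      using near ball M \<open>l > 0\<close> by (intro c_subsolution_growth_along_curve[OF sub cont \<sigma>(1)]) auto
    then have "u z - u y \<le> M * l"
      using \<sigma>(2)[of 0] \<sigma>(3)[of l] by simp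
    also have "\<dots> \<le> M * (dist y z + \<eta>)"
      using l(3) \<open>0 \<le> M\<close> by (intro mult_left_mono)
    also have "\<dots> \<le> M * dist y z + e"
      using \<open>M * \<eta> \<le> e\<close> by (simp add: algebra_simps)
    finally show "u z - u y \<le> M * dist y z + e" .
  qed
  show ?thesis
  proof (rule lipschitz_onI)
    fix y z assume "y \<in> ball x r" "z \<in> ball x r"
    then show "dist (u y) (u z) \<le> M * dist y z"
      using *[of y z] *[of z y] by (auto simp: dist_real_def dist_commute)
  qed (rule \<open>0 \<le> M\<close>)
qed

text \<open>By continuity \<open>f \<le> f x + e\<close> near \<open>x\<close>, so \<open>u\<close>
  is Lipschitz there with constant \<open>f x + e\<close>. Taking \<open>e = 1\<close> gives local
  Lipschitz continuity, and letting \<open>e\<close> tend to \<open>0\<close> bounds the descending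
  slope at \<open>x\<close>.\<close>

lemma c_subsolution_imp_Monge_subsolution:
  fixes \<Omega> :: "'a::length_space set"
  assumes "open \<Omega>" "continuous_on \<Omega> f" "\<forall>x\<in>\<Omega>. 0 \<le> f x" "continuous_on \<Omega> u"
    and sub: "c_subsolution \<Omega> f u"
  shows "Monge_subsolution \<Omega> f u"
proof -
  have local: "\<exists>r>0. (f x + e)-lipschitz_on (ball x r) u" if x: "x \<in> \<Omega>" and e: "e > 0" for x e
  proof -
    obtain r\<^sub>1 where r1: "r\<^sub>1 > 0" "ball x r\<^sub>1 \<subseteq> \<Omega>"
      using \<open>open \<Omega>\<close> x openE by blast
    obtain r\<^sub>2 where r2: "r\<^sub>2 > 0" "\<And>y. y \<in> \<Omega> \<Longrightarrow> dist y x < r\<^sub>2 \<Longrightarrow> dist (f y) (f x) < e"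
      using assms(2) x e unfolding continuous_on_iff by metis
    define r where "r = min r\<^sub>1 r\<^sub>2 / 3"
    have "ball x (3 * r) \<subseteq> \<Omega>"
      using r1 by (auto simp: r_def)
    moreover have "f y \<le> f x + e" if "y \<in> ball x (3 * r)" for y
      using r2(2)[of y] that \<open>ball x (3 * r) \<subseteq> \<Omega>\<close> by (auto simp: r_def dist_commute dist_real_def)
    moreover have "0 \<le> f x + e"
      using assms(3) x e by (simp add: add_nonneg_nonneg)
    ultimately have "(f x + e)-lipschitz_on (ball x r) u"
      by (intro c_subsolution_lipschitz_on_ball[OF sub assms(4)])
    moreover have "r > 0"
      using r1 r2 by (simp add: r_def)
    ultimately show ?thesis by blast
  qed
  have "descending_slope \<Omega> u x \<le> ereal (f x)" if "x \<in> \<Omega>" for x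
  proof (rule ereal_le_epsilon2)
    fix e :: real assume "e > 0"
    obtain r where r: "r > 0" and lip: "(f x + e)-lipschitz_on (ball x r) u"
      using local[OF \<open>x \<in> \<Omega>\<close> \<open>e > 0\<close>] by blast
    have "ereal (max (u x - u y) 0 / dist x y) \<le> ereal (f x + e)" if "dist y x < r" "y \<noteq> x" for y
    proof -
      have "max (u x - u y) 0 \<le> (f x + e) * dist x y"
        using lipschitz_onD[OF lip, of x y] that r lipschitz_on_nonneg[OF lip]
        by (auto simp: dist_real_def dist_commute)
      then show ?thesis
        using that by (simp add: divide_le_eq)
    qed
    then show "descending_slope \<Omega> u x \<le> ereal (f x) + ereal e"
      unfolding descending_slope_def using r
      by (intro Limsup_bounded) (auto simp: eventually_at)
  qed
  moreover have "u \<in> Lip_loc \<Omega>"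
    unfolding Lip_loc_def using local[OF _ zero_less_one] by (blast intro: lipschitz_on_subset)
  ultimately show ?thesis
    by (simp add: Monge_subsolution_def)
qed

section \<open>From Monge subsolutions to c-subsolutions\<close>

text \<open>Since \<open>\<xi>\<close> is 1-Lipschitz, the distance from \<open>x\<close> is at most
  the elapsed time, so a rate of decrease of \<open>u\<close> in time is a lower bound for the rate
  in space. The curve runs on both sides of time \<open>0\<close>, which is why the absolute value
  of the slope is controlled.\<close>

lemma Monge_subsolution_imp_c_subsolution:
  assumes "\<forall>x\<in>\<Omega>. 0 \<le> f x" and cont: "continuous_on \<Omega> u" and sub: "Monge_subsolution \<Omega> f u"
  shows "c_subsolution \<Omega> f u"
  unfolding c_subsolution_def
proof (intro conjI ballI allI impI)
  show "upper_semicontinuous_on \<Omega> u"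
    using cont unfolding upper_semicontinuous_on_def continuous_on_def by (blast intro: order_tendstoD)
next
  fix x \<xi> and \<phi> :: "real \<Rightarrow> real"
  assume x: "x \<in> \<Omega>" and "\<xi> \<in> admissible_curves \<Omega> x"
    and \<phi>: "\<phi> C1_differentiable_on UNIV \<and> (\<forall>\<^sub>F t in nhds 0. u (\<xi> t) - \<phi> t \<le> u (\<xi> 0) - \<phi> 0)"
  then have \<xi>: "range \<xi> \<subseteq> \<Omega>" "1-lipschitz_on UNIV \<xi>" "\<xi> 0 = x"
    by (auto simp: admissible_curves_iff)
  define d where "d = deriv \<phi> 0"
  have d: "(\<phi> has_real_derivative d) (at 0)"
    using \<phi> unfolding C1_differentiable_on_eq d_def
    by (metis UNIV_I DERIV_imp_deriv has_real_derivative_iff_has_vector_derivative vector_derivative_works)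
  show "\<bar>deriv \<phi> 0\<bar> \<le> f x"
  proof (rule ccontr)
    assume "\<not> ?thesis"
    then obtain m where m: "f x < m" "m < \<bar>d\<bar>"
      unfolding d_def by (meson dense not_le)
    have "m > 0"
      using m assms(1) x by force
    have "descending_slope \<Omega> u x < ereal m"
      using sub x m(1) unfolding Monge_subsolution_def by (meson ereal_less(2) less_ereal.simps(1) order_le_less_trans)
    then have "\<forall>\<^sub>F y in at x within \<Omega>. ereal (max (u x - u y) 0 / dist x y) < ereal m"
      unfolding descending_slope_def by (rule Limsup_lessD)
    then have "\<forall>\<^sub>F y in at x within \<Omega>. u x - u y \<le> m * dist x y"
      by (rule eventually_mp[rotated]) (auto simp: eventually_at divide_less_eq intro!: exI[of _ 1])
    \<comment> \<open>At \<open>y = x\<close> both sides vanish, so the estimate extends to the full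
      neighbourhood; the curve may well return to \<open>x\<close>.\<close>
    then obtain r where r: "r > 0" "\<And>y. y \<in> \<Omega> \<Longrightarrow> dist y x < r \<Longrightarrow> u x - u y \<le> m * dist x y"
      unfolding eventually_at by (metis diff_self dist_self mult_zero_right order_refl)
    have ev1: "\<forall>\<^sub>F t in at 0. u (\<xi> t) - \<phi> t \<le> u x - \<phi> 0"
      using \<phi> \<xi>(3) by (auto simp: eventually_at_filter elim: eventually_mono)
    have ev2: "\<forall>\<^sub>F t in at 0. \<bar>t\<bar> < r"
      using r(1) by (auto simp: eventually_at dist_real_def)
    \<comment> \<open>The factor \<open>sgn d\<close> treats both signs of \<open>d\<close> at once:
      the limit is \<open>\<bar>d\<bar>\<close>.\<close>
    have "((\<lambda>t. sgn d * ((\<phi> t - \<phi> 0) / t)) \<longlongrightarrow> sgn d * d) (at 0)"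
      using d[unfolded DERIV_def] by (intro tendsto_intros) simp
    then have ev3: "\<forall>\<^sub>F t in at 0. m < sgn d * ((\<phi> t - \<phi> 0) / t)"
      using m(2) by (intro order_tendstoD(1)) (auto simp: abs_sgn mult.commute)
    obtain \<delta> where \<delta>: "\<delta> > 0" "\<And>t. t \<noteq> 0 \<Longrightarrow> \<bar>t\<bar> < \<delta> \<Longrightarrow>
        u (\<xi> t) - \<phi> t \<le> u x - \<phi> 0 \<and> \<bar>t\<bar> < r \<and> m < sgn d * ((\<phi> t - \<phi> 0) / t)"
      using eventually_conj[OF ev1 eventually_conj[OF ev2 ev3]]
      by (auto simp: eventually_at dist_real_def)
    \<comment> \<open>A time of sign opposite to \<open>d\<close>, so that \<open>\<phi> t\<close>
      is below \<open>\<phi> 0\<close>.\<close>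
    define t where "t = - sgn d * (\<delta> / 2)"
    have "d \<noteq> 0"
      using m \<open>m > 0\<close> by auto
    then have t: "t \<noteq> 0" "\<bar>t\<bar> = \<delta> / 2" "\<bar>t\<bar> < \<delta>" "sgn d * \<bar>t\<bar> = - t"
      using \<delta>(1) by (auto simp: t_def abs_mult sgn_if)
    note at_t = \<delta>(2)[OF t(1,3)]
    have "m * \<bar>t\<bar> < sgn d * ((\<phi> t - \<phi> 0) / t) * \<bar>t\<bar>"
      using at_t t(1) by (intro mult_strict_right_mono) auto
    also have "\<dots> = (sgn d * \<bar>t\<bar>) * ((\<phi> t - \<phi> 0) / t)"
      by simp
    also have "\<dots> = \<phi> 0 - \<phi> t"
      unfolding t(4) using t(1) by simp
    also have "\<dots> \<le> u x - u (\<xi> t)"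
      using at_t by linarith
    finally have "m * \<bar>t\<bar> < u x - u (\<xi> t)" .
    moreover have "dist (\<xi> t) x \<le> \<bar>t\<bar>"
      using lipschitz_onD[OF \<xi>(2), of t 0] \<xi>(3) by simp
    moreover from this have "u x - u (\<xi> t) \<le> m * dist x (\<xi> t)"
      using at_t \<xi>(1) by (intro r(2)) auto
    moreover have "m * dist x (\<xi> t) \<le> m * \<bar>t\<bar>"
      using \<open>dist (\<xi> t) x \<le> \<bar>t\<bar>\<close> \<open>m > 0\<close> by (simp add: dist_commute)
    ultimately show False
      by linarith
  qed
qed

theorem proposition4p5:
  fixes \<Omega> :: "'a::{complete_space, length_space} set"
    and f u :: "'a \<Rightarrow> real"
  assumes "open \<Omega>"
    and "continuous_on \<Omega> f"
    and "\<forall>x\<in>\<Omega>. 0 \<le> f x"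
    and "continuous_on \<Omega> u"
  shows "c_subsolution \<Omega> f u \<longleftrightarrow> Monge_subsolution \<Omega> f u"
  using c_subsolution_imp_Monge_subsolution[OF assms]
    Monge_subsolution_imp_c_subsolution[OF assms(3,4)] by blast

end
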